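(* For connected graphs $G$ and integers $r\ge 3$, $\mathscr{Z}(G)=K_r$ if and only if $G=K_r$ or $G=K_{1,r}$.
   Context: All graphs are finite, simple and undirected (with nonempty vertex set); equality of graphs here means isomorphism. $K_r$ is the complete graph on $r$ vertices and $K_{1,r}$ is the star with $r$ leaves. Zero forcing: vertices of a graph $G$ are colored blue or white; the color change rule says that a blue vertex $u$ can change the color of a white vertex $w$ to blue if $w$ is the unique white neighbor of $u$. A set $B\subseteq V(G)$ is a zero forcing set of $G$ if, starting with exactly the vertices of $B$ blue and applying the color change rule repeatedly, all vertices eventually become blue. The zero forcing number $\operatorname{Z}(G)$ is the minimum of $|B|$ over all zero forcing sets $B$ of $G$; a minimum zero forcing set is a zero forcing set $B$ with $|B|=\operatorname{Z}(G)$. The zero forcing graph $\mathscr{Z}(G)$ is the graph whose vertices are the minimum zero forcing sets of $G$, with two of them adjacent if and only if their symmetric difference has exactly two elements. *)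

theory Defs
  imports "Graph_Theory.Graph_Theory"
begin

text \<open>
  Finite simple undirected graphs are the locale \<open>graph\<close> of \<open>Graph_Theory\<close>, i.e.\ finite
  symmetric digraphs without loops and parallel arcs, so that \<open>dominates G\<close> is the
  adjacency relation. Isomorphism with a complete or a complete bipartite graph is expressed by the
  library predicates \<open>complete_digraph\<close> and \<open>complete_bipartite_digraph\<close>.
\<close>

definition neighbors :: "('a, 'b) pre_digraph \<Rightarrow> 'a \<Rightarrow> 'a set" where
  "neighbors G u = {w. u \<rightarrow>\<^bsub>G\<^esub> w}"

text \<open>\<open>color_change G B B'\<close>: one application of the color change rule turns the blue set
  \<open>B\<close> into \<open>B'\<close>; the white vertices are those outside \<open>B\<close>.\<close>

definition color_change :: "('a, 'b) pre_digraph \<Rightarrow> 'a set \<Rightarrow> 'a set \<Rightarrow> bool" where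
  "color_change G B B' \<longleftrightarrow>
     (\<exists>u \<in> B. \<exists>w. neighbors G u - B = {w} \<and> B' = insert w B)"

definition zero_forcing_set :: "('a, 'b) pre_digraph \<Rightarrow> 'a set \<Rightarrow> bool" where
  "zero_forcing_set G B \<longleftrightarrow> B \<subseteq> verts G \<and> (color_change G)\<^sup>*\<^sup>* B (verts G)"

definition zero_forcing_number :: "('a, 'b) pre_digraph \<Rightarrow> nat" where
  "zero_forcing_number G = (LEAST k. \<exists>B. zero_forcing_set G B \<and> card B = k)"

definition min_zero_forcing_set :: "('a, 'b) pre_digraph \<Rightarrow> 'a set \<Rightarrow> bool" where
  "min_zero_forcing_set G B \<longleftrightarrow> zero_forcing_set G B \<and> card B = zero_forcing_number G"

definition zero_forcing_graph :: "('a, 'b) pre_digraph \<Rightarrow> 'a set pair_pre_digraph" where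
  "zero_forcing_graph G =
     \<lparr> pverts = {B. min_zero_forcing_set G B},
       parcs = {(A, B). min_zero_forcing_set G A \<and> min_zero_forcing_set G B \<and>
                        card ((A - B) \<union> (B - A)) = 2} \<rparr>"

end

theory Submission
  imports Defs
begin

text \<open>
  Reversing the forces of a zero forcing process turns the set of vertices that never force into a
  zero forcing set of the same size. Since one is free to choose when a vertex forces, this shows
  that a connected graph with at least two vertices has no vertex common to all minimum zero forcing
  sets. A family of \<open>k\<close>-sets pairwise at symmetric difference two either shares a
  common \<open>(k - 1)\<close>-set or lies in a common \<open>(k + 1)\<close>-set \<open>T\<close>. In the first case that set is empty, so
  \<open>k = 1\<close>; but when a single vertex is blue initially, all other vertices except the last one force
  and hence have degree at least two, whereas the members of the family are leaves.
  In the second case the minimum zero forcing sets are exactly the sets \<open>T - {v}\<close>, and by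
  reversal exactly one vertex of \<open>T\<close> forces, so that all vertices of \<open>T - {v}\<close> have the same single white
  neighbour. Minimality and connectedness then leave only \<open>K\<^sub>r\<close> (if \<open>T\<close> is the whole vertex set) and \<open>K\<^sub>1\<^sub>,\<^sub>r\<close>.
\<close>

text \<open>In \<open>forcing G B C U\<close> the set \<open>U\<close> collects the vertices that have forced while the blue set
  grew from \<open>B\<close> to \<open>C\<close>.\<close>

inductive forcing :: "('a, 'b) pre_digraph \<Rightarrow> 'a set \<Rightarrow> 'a set \<Rightarrow> 'a set \<Rightarrow> bool" for G B where
  init: "forcing G B B {}"
| force: "\<lbrakk>forcing G B C U; u \<in> C; neighbors G u - C = {w}\<rbrakk> \<Longrightarrow>
    forcing G B (insert w C) (insert u U)"

section \<open>Zero forcing sets as a condition on blue supersets\<close>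

lemma color_change_superset:
  assumes "(color_change G)\<^sup>*\<^sup>* B D" "B \<subseteq> C" "\<not> D \<subseteq> C"
  shows "\<exists>u \<in> C. \<exists>w. neighbors G u - C = {w}"
  using assms
proof (induction rule: rtranclp_induct)
  case base
  then show ?case by simp
next
  case (step D E)
  show ?case
  proof (cases "D \<subseteq> C")
    case True
    \<comment> \<open>This is the first force whose result leaves \<open>C\<close>. Its forcer lies
      in \<open>C\<close> and \<open>w\<close> does not, so the same force is available from
      \<open>C\<close>.\<close>
    obtain u w where "u \<in> D" "neighbors G u - D = {w}" "E = insert w D"
      using step(2) unfolding color_change_def by blast
    then have "u \<in> C" "neighbors G u - C = {w}" using True step.prems by auto
    then show ?thesis by blast
  qed (use step in simp)
qed

lemma zero_forcing_number_le:
  assumes "zero_forcing_set G B"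
  shows "zero_forcing_number G \<le> card B"
  using assms unfolding zero_forcing_number_def by (metis (mono_tags, lifting) Least_le)

lemma (in graph) neighbors_subset: "neighbors G u \<subseteq> verts G"
  by (auto simp: neighbors_def dest: adj_in_verts)

lemma (in graph) neighbors_sym: "v \<in> neighbors G u \<Longrightarrow> u \<in> neighbors G v"
  using arcs_ends_symmetric[OF sym_arcs] by (simp add: neighbors_def)

lemma (in graph) not_self_neighbor: "u \<notin> neighbors G u"
  using adj_not_same by (auto simp: neighbors_def)

text \<open>Order-free form: no proper superset of \<open>B\<close> is stuck. The process can thus
  be continued from any blue set containing \<open>B\<close>, whichever forces came before.\<close>

lemma (in graph) zero_forcing_set_iff:
  "zero_forcing_set G B \<longleftrightarrow>
    B \<subseteq> verts G \<and> (\<forall>C. B \<subseteq> C \<and> C \<subset> verts G \<longrightarrow> (\<exists>u \<in> C. \<exists>w. neighbors G u - C = {w}))"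
proof
  assume "zero_forcing_set G B"
  then show "B \<subseteq> verts G \<and> (\<forall>C. B \<subseteq> C \<and> C \<subset> verts G \<longrightarrow> (\<exists>u \<in> C. \<exists>w. neighbors G u - C = {w}))"
    unfolding zero_forcing_set_def using color_change_superset[of G B "verts G"] by blast
next
  assume B: "B \<subseteq> verts G \<and> (\<forall>C. B \<subseteq> C \<and> C \<subset> verts G \<longrightarrow> (\<exists>u \<in> C. \<exists>w. neighbors G u - C = {w}))"
  have "(color_change G)\<^sup>*\<^sup>* C (verts G)" if "B \<subseteq> C" "C \<subseteq> verts G" for C
    using that
  proof (induction "card (verts G - C)" arbitrary: C rule: less_induct)
    case less
    show ?case
    proof (cases "C = verts G")
      case False
      with B less.prems obtain u w where uw: "u \<in> C" "neighbors G u - C = {w}" by blast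
      then have w: "w \<in> verts G" "w \<notin> C" using neighbors_subset by blast+
      have "card (verts G - insert w C) < card (verts G - C)"
        using w by (intro psubset_card_mono) auto
      then have "(color_change G)\<^sup>*\<^sup>* (insert w C) (verts G)"
        using less.prems w by (intro less.hyps) auto
      moreover have "color_change G C (insert w C)" using uw by (auto simp: color_change_def)
      ultimately show ?thesis by (rule converse_rtranclp_into_rtranclp[rotated])
    qed simp
  qed
  then show "zero_forcing_set G B" using B by (simp add: zero_forcing_set_def)
qed

lemma (in graph) zero_forcing_setD:
  assumes "zero_forcing_set G B" "B \<subseteq> C" "C \<subseteq> verts G" "C \<noteq> verts G"
  obtains u w where "u \<in> C" "neighbors G u - C = {w}"
  using assms unfolding zero_forcing_set_iff by blast

section \<open>Reversing forces and choosing who forces\<close>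

context graph
begin

lemma forcing_invariants:
  assumes "forcing G B C U" "B \<subseteq> verts G"
  shows "B \<subseteq> C" "C \<subseteq> verts G" "U \<subseteq> C" "\<And>u. u \<in> U \<Longrightarrow> neighbors G u \<subseteq> C"
    "card C = card B + card U" "zero_forcing_set G (verts G - U)"
proof -
  have "B \<subseteq> C \<and> C \<subseteq> verts G \<and> U \<subseteq> C \<and> (\<forall>u\<in>U. neighbors G u \<subseteq> C) \<and> card C = card B + card U \<and>
    (color_change G)\<^sup>*\<^sup>* (verts G - U) (verts G)"
    using assms
  proof induction
    case init
    then show ?case by simp
  next
    case (force C U u w)
    then have IH: "B \<subseteq> C" "C \<subseteq> verts G" "U \<subseteq> C" "\<And>u. u \<in> U \<Longrightarrow> neighbors G u \<subseteq> C"
      "card C = card B + card U" "(color_change G)\<^sup>*\<^sup>* (verts G - U) (verts G)" by auto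
    have w: "w \<in> neighbors G u" "w \<notin> C" "w \<in> verts G"
      using force neighbors_subset by blast+
    have u: "u \<notin> U" using IH(4) w by blast
    have fin: "finite C" "finite U" using IH finite_subset[OF _ finite_verts] by blast+
    \<comment> \<open>Reversal of one force: all neighbors of earlier forcers are blue, whereas
      \<open>w\<close> is still white. So once the forcers become the white vertices,
      \<open>u\<close> is the only white neighbor of \<open>w\<close>.\<close>
    have "neighbors G w \<inter> U = {}" using IH(4) neighbors_sym w(2) by blast
    then have "neighbors G w - (verts G - insert u U) = {u}"
      using neighbors_sym[OF w(1)] neighbors_subset by blast
    moreover have "w \<in> verts G - insert u U" using w IH force.hyps by auto
    moreover have "verts G - U = insert u (verts G - insert u U)"
      using u IH force.hyps by auto
    ultimately have "color_change G (verts G - insert u U) (verts G - U)"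
      unfolding color_change_def by blast
    then have "(color_change G)\<^sup>*\<^sup>* (verts G - insert u U) (verts G)"
      using IH(6) by (rule converse_rtranclp_into_rtranclp)
    moreover have "\<forall>v\<in>insert u U. neighbors G v \<subseteq> insert w C" using IH(4) force.hyps(3) by blast
    ultimately show ?case using IH w u fin force.hyps by auto
  qed
  then show "B \<subseteq> C" "C \<subseteq> verts G" "U \<subseteq> C" "\<And>u. u \<in> U \<Longrightarrow> neighbors G u \<subseteq> C"
    "card C = card B + card U" "zero_forcing_set G (verts G - U)"
    by (auto simp: zero_forcing_set_def)
qed

lemma min_zero_forcing_set_terminus:
  assumes "min_zero_forcing_set G B" "forcing G B (verts G) U"
  shows "min_zero_forcing_set G (verts G - U)"
proof -
  have B: "B \<subseteq> verts G" using assms(1) by (simp add: min_zero_forcing_set_def zero_forcing_set_def)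
  note inv = forcing_invariants[OF assms(2) B]
  have "card (verts G - U) = card B"
    using inv by (simp add: card_Diff_subset finite_subset)
  then show ?thesis using inv assms(1) by (simp add: min_zero_forcing_set_def)
qed

lemma forcing_extend:
  assumes "zero_forcing_set G B" "forcing G B C U"
  shows "\<exists>U'. forcing G B (verts G) U' \<and> U \<subseteq> U'"
  using assms(2)
proof (induction "card (verts G - C)" arbitrary: C U rule: less_induct)
  case less
  have "B \<subseteq> verts G" using assms(1) by (simp add: zero_forcing_set_def)
  note inv = forcing_invariants[OF less.prems this]
  show ?case
  proof (cases "C = verts G")
    case False
    with zero_forcing_setD[OF assms(1)] inv
    obtain u w where uw: "u \<in> C" "neighbors G u - C = {w}" by metis
    then have w: "w \<in> verts G" "w \<notin> C" using neighbors_subset by blast+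
    have "card (verts G - insert w C) < card (verts G - C)"
      using w by (intro psubset_card_mono) auto
    then show ?thesis using less.hyps[OF _ force[OF less.prems uw]] by auto
  qed (use less.prems in blast)
qed

text \<open>Other vertices force while \<open>x\<close> waits. Whenever the next vertex to be forced
  is the last white neighbor of \<open>x\<close>, that force is handed to \<open>x\<close>; any
  other force leaves \<open>x\<close> with a white neighbor.\<close>

lemma forcing_extend_by:
  assumes "zero_forcing_set G B" "forcing G B C U" "x \<in> C" "neighbors G x - C \<noteq> {}"
  shows "\<exists>U'. forcing G B (verts G) U' \<and> insert x U \<subseteq> U'"
  using assms(2-)
proof (induction "card (verts G - C)" arbitrary: C U rule: less_induct)
  case less
  have "B \<subseteq> verts G" using assms(1) by (simp add: zero_forcing_set_def)
  note inv = forcing_invariants[OF less.prems(1) this]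
  have "C \<noteq> verts G" using less.prems(3) neighbors_subset by blast
  with zero_forcing_setD[OF assms(1)] inv
  obtain u w where uw: "u \<in> C" "neighbors G u - C = {w}" by metis
  then have w: "w \<in> verts G" "w \<notin> C" using neighbors_subset by blast+
  show ?case
  proof (cases "neighbors G x - C = {w}")
    case True
    show ?thesis
      using forcing_extend[OF assms(1) force[OF less.prems(1,2) True]] .
  next
    case False
    have "card (verts G - insert w C) < card (verts G - C)"
      using w by (intro psubset_card_mono) auto
    moreover have "neighbors G x - insert w C \<noteq> {}" using False less.prems(3) by blast
    ultimately show ?thesis
      using less.hyps[OF _ force[OF less.prems(1) uw]] less.prems(2) by blast
  qed
qed

text \<open>If all neighbors of \<open>x\<close> were blue, one of them could be removed from
  \<open>B\<close>, because \<open>x\<close> would force it back.\<close>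

lemma min_zero_forcing_set_white_neighbor:
  assumes "min_zero_forcing_set G B" "x \<in> B" "neighbors G x \<noteq> {}"
  shows "neighbors G x - B \<noteq> {}"
proof
  assume eq: "neighbors G x - B = {}"
  obtain w where w: "w \<in> neighbors G x" using assms(3) by blast
  then have wx: "w \<in> B" "w \<noteq> x" using eq not_self_neighbor by auto
  have B: "zero_forcing_set G B" "B \<subseteq> verts G"
    using assms(1) by (auto simp: min_zero_forcing_set_def zero_forcing_set_def)
  have "zero_forcing_set G (B - {w})"
    unfolding zero_forcing_set_iff
  proof (intro conjI allI impI)
    fix C assume C: "B - {w} \<subseteq> C \<and> C \<subset> verts G"
    show "\<exists>u\<in>C. \<exists>w. neighbors G u - C = {w}"
    proof (cases "w \<in> C")
      case True
      then have "B \<subseteq> C" using C by auto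
      then show ?thesis using B C unfolding zero_forcing_set_iff by blast
    next
      case False
      then have "neighbors G x - C = {w}" "x \<in> C" using eq w wx assms(2) C by auto
      then show ?thesis by blast
    qed
  qed (use B in auto)
  then have "zero_forcing_number G \<le> card (B - {w})" by (rule zero_forcing_number_le)
  moreover have "card (B - {w}) < card B"
    using wx B finite_subset[OF B(2) finite_verts] by (intro card_Diff1_less)
  ultimately show False using assms(1) by (simp add: min_zero_forcing_set_def)
qed

text \<open>If \<open>x\<close> is in \<open>B\<close>, let \<open>x\<close> force at some point;
  the set of vertices that never force then omits \<open>x\<close>.\<close>

lemma min_zero_forcing_set_avoiding:
  assumes "min_zero_forcing_set G B" "neighbors G x \<noteq> {}"
  shows "\<exists>B'. min_zero_forcing_set G B' \<and> x \<notin> B'"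
proof (cases "x \<in> B")
  case True
  have "zero_forcing_set G B" using assms by (simp add: min_zero_forcing_set_def)
  then obtain U where "forcing G B (verts G) U" "x \<in> U"
    using forcing_extend_by[OF _ init True min_zero_forcing_set_white_neighbor[OF assms(1) True assms(2)]]
    by auto
  then show ?thesis using min_zero_forcing_set_terminus[OF assms(1)] by blast
qed (use assms in blast)

lemma forced_by:
  "forcing G B C U \<Longrightarrow> y \<in> C - B \<Longrightarrow> neighbors G y \<inter> U \<noteq> {}"
  by (induction rule: forcing.induct) (use neighbors_sym in blast)+

text \<open>A forcer outside \<open>B\<close> was itself forced, so it has an already blue neighbor
  besides the white one that it forces.\<close>

lemma forcer_two_neighbors:
  assumes "forcing G B C U" "B \<subseteq> verts G" "y \<in> U - B"
  shows "\<exists>a b. a \<in> neighbors G y \<and> b \<in> neighbors G y \<and> a \<noteq> b"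
  using assms
proof induction
  case (force C U u w)
  show ?case
  proof (cases "y = u")
    case True
    then obtain a where "a \<in> neighbors G u" "a \<in> U" using forced_by[OF force.hyps(1)] force by blast
    moreover have "U \<subseteq> C" using forcing_invariants(3)[OF force.hyps(1)] force.prems by blast
    ultimately show ?thesis using True force.hyps(3) by blast
  qed (use force in blast)
qed simp

lemma singleton_zero_forcing_sets:
  assumes "zero_forcing_set G {x}" "zero_forcing_set G {y}" "zero_forcing_set G {z}"
    "x \<noteq> y" "x \<noteq> z" "y \<noteq> z"
  shows False
proof -
  \<comment> \<open>With \<open>a\<close> alone blue, the first force must come from
    \<open>a\<close>.\<close>
  have leaf: "\<exists>w. neighbors G a = {w}" if a: "zero_forcing_set G {a}" "b \<in> verts G" "b \<noteq> a" for a b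
  proof -
    have "a \<in> verts G" using a by (simp add: zero_forcing_set_def)
    then obtain w where "neighbors G a - {a} = {w}"
      using zero_forcing_setD[OF a(1), of "{a}"] a by blast
    then show ?thesis using not_self_neighbor by auto
  qed
  have V: "x \<in> verts G" "y \<in> verts G" "z \<in> verts G"
    using assms by (auto simp: zero_forcing_set_def)
  obtain U where U: "forcing G {x} (verts G) U"
    using forcing_extend[OF assms(1) init] by blast
  note inv = forcing_invariants[OF U]
  have card: "card (verts G) = 1 + card U" using inv V by simp
  \<comment> \<open>Only one vertex lies outside \<open>U\<close>, so \<open>y\<close> and
    \<open>z\<close> cannot both avoid forcing.\<close>
  have "y \<in> U \<or> z \<in> U"
  proof (rule ccontr)
    assume "\<not> ?thesis"
    then have "U \<subseteq> verts G - {y, z}" using inv(3) V by auto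
    then have "card U \<le> card (verts G - {y, z})" by (intro card_mono) auto
    also have "\<dots> = card (verts G) - 2" using V assms by (simp add: card_Diff_subset)
    finally show False using card card_mono[of "verts G" "{y, z}"] V assms by simp
  qed
  then obtain a where a: "a \<in> {y, z}" "a \<in> U - {x}" using assms by auto
  obtain p where "neighbors G a = {p}" using a leaf[of a x] assms V by auto
  then show False using forcer_two_neighbors[OF U _ a(2)] V by auto
qed

end

section \<open>Families of sets at pairwise symmetric difference two\<close>

lemma family_symmetric_difference_two:
  assumes fin: "\<And>A. A \<in> F \<Longrightarrow> finite A" and card: "\<And>A. A \<in> F \<Longrightarrow> card A = k"
    and two: "\<And>A B. A \<in> F \<Longrightarrow> B \<in> F \<Longrightarrow> A \<noteq> B \<Longrightarrow> card ((A - B) \<union> (B - A)) = 2"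
    and AB: "A \<in> F" "B \<in> F" "A \<noteq> B"
  obtains (common) S where "\<And>D. D \<in> F \<Longrightarrow> S \<subseteq> D" "Suc (card S) = k"
    | (union) T where "finite T" "card T = Suc k" "\<And>D. D \<in> F \<Longrightarrow> D \<subseteq> T"
proof -
  have diff: "\<exists>a. D - E = {a}" if "D \<in> F" "E \<in> F" "D \<noteq> E" for D E
  proof -
    have "card (D - E) + card (E - D) = 2"
      using two[OF that] fin that by (subst (asm) card_Un_disjoint) auto
    moreover have "card (D - E) = card (E - D)"
      using fin card that by (metis Int_commute card_Diff_subset_Int finite_Int)
    ultimately have "card (D - E) = 1" by simp
    then show ?thesis by (simp add: card_1_singleton_iff)
  qed
  obtain a b where ab: "A - B = {a}" "B - A = {b}" using diff AB by metis
  define S where "S = A \<inter> B"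
  have S: "A = insert a S" "B = insert b S" "a \<notin> S" "b \<notin> S" "a \<noteq> b" using ab S_def by auto
  have finS: "finite S" using fin[OF AB(1)] S_def by simp
  show thesis
  proof (cases "\<forall>D \<in> F. S \<subseteq> D")
    case True
    show thesis using True S finS card[OF AB(1)] by (intro common[of S]) auto
  next
    case False
    then obtain D s where D: "D \<in> F" "s \<in> S" "s \<notin> D" by blast
    have single: "X - Y = {x}" if "X \<in> F" "Y \<in> F" "x \<in> X" "x \<notin> Y" for X Y x
    proof -
      obtain a where "X - Y = {a}" using diff[of X Y] \<open>X \<in> F\<close> \<open>Y \<in> F\<close> \<open>x \<in> X\<close> \<open>x \<notin> Y\<close> by metis
      then show ?thesis using \<open>x \<in> X\<close> \<open>x \<notin> Y\<close> by (metis Diff_iff singletonD)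
    qed
    \<comment> \<open>Having lost \<open>s\<close>, the set \<open>D\<close> must keep the rest of
      \<open>A\<close> and \<open>B\<close>, in particular both \<open>a\<close> and
      \<open>b\<close>.\<close>
    have DA: "A - D = {s}" "B - D = {s}" using D AB S by (auto intro!: single del: equalityI)
    have sub: "E \<subseteq> insert a (insert b S)" if E: "E \<in> F" for E
    proof (rule ccontr)
      assume "\<not> ?thesis"
      then obtain e where e: "e \<in> E" "e \<notin> A" "e \<notin> B" using S by blast
      \<comment> \<open>An element \<open>e\<close> outside \<open>A\<close> and \<open>B\<close>
        uses up the whole difference to each of them, so \<open>E\<close> contains neither
        \<open>a\<close> nor \<open>b\<close>. But \<open>D\<close> contains both, which makes
        \<open>D - E\<close> too large.\<close>
      have "E - A = {e}" "E - B = {e}" using e E AB by (auto intro!: single del: equalityI)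
      then have nE: "a \<notin> E" "b \<notin> E" using S by auto
      have "A - E = {a}" using single[of A E a] AB E S nE(1) by blast
      have "a \<in> D" "b \<in> D" using DA S(1-4) D(2) by (metis Diff_iff insertI1 singletonD)+
      moreover from this have "D - E = {a}" using single[OF D(1) E] nE(1) by blast
      ultimately show False using nE(2) S(5) by (metis Diff_iff singletonD)
    qed
    show thesis
      using sub S finS card[OF AB(1)] by (intro union[of "insert a (insert b S)"]) auto
  qed
qed

text \<open>Symmetric difference two already excludes \<open>A = B\<close>, so completeness is a
  condition on pairs of distinct sets only.\<close>

lemma complete_digraph_zero_forcing_graph_iff:
  fixes G :: "('a, 'b) pre_digraph"
  shows "complete_digraph r (with_proj (zero_forcing_graph G)) \<longleftrightarrow>
    finite {B. min_zero_forcing_set G B} \<and> card {B. min_zero_forcing_set G B} = r \<and>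
    (\<forall>A B. min_zero_forcing_set G A \<longrightarrow> min_zero_forcing_set G B \<longrightarrow> A \<noteq> B \<longrightarrow>
      card ((A - B) \<union> (B - A)) = 2)"
proof -
  have "A \<noteq> B" if "card ((A - B) \<union> (B - A)) = 2" for A B :: "'a set"
    using that by force
  then show ?thesis
    unfolding complete_digraph_pair_def zero_forcing_graph_def
    by (simp add: set_eq_iff[where 'a = "'a set \<times> 'a set"]) metis
qed

lemma bij_betw_delete: "bij_betw (\<lambda>v. T - {v}) T ((\<lambda>v. T - {v}) ` T)"
  by (auto simp: bij_betw_def inj_on_def)

section \<open>Zero forcing graphs of complete graphs and stars\<close>

context graph
begin

text \<open>Common criterion, used with \<open>T\<close> the whole vertex set for
  \<open>K\<^sub>r\<close> and the set of leaves for \<open>K\<^sub>1\<^sub>,\<^sub>r\<close>. By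
  \<open>ge\<close> every zero forcing set has at least \<open>r - 1\<close> elements in
  \<open>T\<close>, so the minimum ones are exactly the sets \<open>T - {v}\<close>.\<close>

lemma complete_zero_forcing_graphI:
  assumes T: "finite T" "card T = r" "r > 0"
    and zfs: "\<And>v. v \<in> T \<Longrightarrow> zero_forcing_set G (T - {v})"
    and ge: "\<And>B. zero_forcing_set G B \<Longrightarrow> card (T - B) \<le> 1"
  shows "complete_digraph r (with_proj (zero_forcing_graph G))"
proof -
  have le: "r - 1 \<le> card (T \<inter> B)" if "zero_forcing_set G B" for B
    using ge[OF that] T card_Diff_subset_Int[of T B] by simp
  have fin: "finite B" if "zero_forcing_set G B" for B
    using that finite_subset[OF _ finite_verts] by (auto simp: zero_forcing_set_def)
  obtain v where v: "v \<in> T" using T by fastforce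
  have Z: "zero_forcing_number G = r - 1"
    unfolding zero_forcing_number_def
  proof (rule Least_equality)
    show "\<exists>B. zero_forcing_set G B \<and> card B = r - 1"
      using zfs[OF v] v T by (intro exI[of _ "T - {v}"]) simp
    show "r - 1 \<le> k" if "\<exists>B. zero_forcing_set G B \<and> card B = k" for k
      using that le fin by (meson card_mono inf_le2 le_trans)
  qed
  have eq: "{B. min_zero_forcing_set G B} = (\<lambda>v. T - {v}) ` T"
  proof (intro equalityI subsetI)
    fix B assume "B \<in> {B. min_zero_forcing_set G B}"
    then have B: "zero_forcing_set G B" "card B = r - 1"
      using Z by (auto simp: min_zero_forcing_set_def)
    then have "T \<inter> B = B" using le fin by (intro card_seteq) auto
    then have "B \<subseteq> T" by blast
    then have "card (T - B) = 1" using B T fin by (simp add: card_Diff_subset)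
    then obtain a where "T - B = {a}" by (meson card_1_singletonE)
    then have "B = T - {a}" "a \<in> T" using \<open>B \<subseteq> T\<close> by auto
    then show "B \<in> (\<lambda>v. T - {v}) ` T" by blast
  qed (use Z zfs T in \<open>auto simp: min_zero_forcing_set_def\<close>)
  have "card ((\<lambda>v. T - {v}) ` T) = r"
    using bij_betw_same_card[OF bij_betw_delete] T by metis
  moreover have "card ((T - {a}) - (T - {b}) \<union> ((T - {b}) - (T - {a}))) = 2"
    if "a \<in> T" "b \<in> T" "a \<noteq> b" for a b
  proof -
    have "(T - {a}) - (T - {b}) \<union> ((T - {b}) - (T - {a})) = {a, b}" using that by auto
    then show ?thesis using that by simp
  qed
  ultimately show ?thesis
    unfolding complete_digraph_zero_forcing_graph_iff using T
    by (simp only: eq mem_Collect_eq[symmetric, of "min_zero_forcing_set G"]) auto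
qed

lemma zero_forcing_graph_complete:
  assumes "complete_digraph r G" "r \<ge> 2"
  shows "complete_digraph r (with_proj (zero_forcing_graph G))"
proof (rule complete_zero_forcing_graphI[of "verts G"])
  have N: "neighbors G u = verts G - {u}" if "u \<in> verts G" for u
    using assms that by (auto simp: complete_digraph_def neighbors_def)
  show card: "card (verts G) = r" using assms by (simp add: complete_digraph_def)
  show "zero_forcing_set G (verts G - {v})" if v: "v \<in> verts G" for v
    unfolding zero_forcing_set_iff
  proof (intro conjI allI impI)
    fix C assume "verts G - {v} \<subseteq> C \<and> C \<subset> verts G"
    then have C: "C = verts G - {v}" by auto
    \<comment> \<open>Here \<open>r \<ge> 2\<close> provides a blue vertex to force
      \<open>v\<close>.\<close>
    have "card C \<noteq> 0" using C card assms v by simp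
    then obtain u where "u \<in> C" by fastforce
    then have "u \<in> C \<and> neighbors G u - C = {v}" using N C v by auto
    then show "\<exists>u \<in> C. \<exists>w. neighbors G u - C = {w}" by blast
  qed auto
  show "card (verts G - B) \<le> 1" if B: "zero_forcing_set G B" for B
  proof (cases "B = verts G")
    case False
    have sub: "B \<subseteq> verts G" using B by (simp add: zero_forcing_set_def)
    \<comment> \<open>The first forcer sees every white vertex, so only one vertex is white.\<close>
    obtain u w where "u \<in> B" "neighbors G u - B = {w}"
      using zero_forcing_setD[OF B _ sub False] by blast
    then have "verts G - B = {w}" using N sub by auto
    then show ?thesis by simp
  qed simp
qed (use assms in auto)

lemma zero_forcing_graph_star:
  assumes "complete_bipartite_digraph 1 r G" "r \<ge> 2"
  shows "complete_digraph r (with_proj (zero_forcing_graph G))"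
proof -
  obtain C L where CL: "verts G = C \<union> L" "C \<inter> L = {}" "card C = 1" "card L = r"
    and arcs: "arcs_ends G = C \<times> L \<union> L \<times> C"
    using assms unfolding complete_bipartite_digraph_def by blast
  obtain c where c: "C = {c}" using CL(3) by (rule card_1_singletonE)
  have L: "verts G = insert c L" "c \<notin> L" "card L = r" using CL c by auto
  have E: "arcs_ends G = {c} \<times> L \<union> L \<times> {c}" using arcs c by simp
  have Nc: "neighbors G c = L" and Nl: "\<And>x. x \<in> L \<Longrightarrow> neighbors G x = {c}"
    using E L by (auto simp: neighbors_def)
  have fin: "finite L" using finite_verts L by simp
  show ?thesis
  proof (rule complete_zero_forcing_graphI[OF fin L(3)])
    show "zero_forcing_set G (L - {v})" if v: "v \<in> L" for v
      unfolding zero_forcing_set_iff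
    proof (intro conjI allI impI)
      fix C assume C: "L - {v} \<subseteq> C \<and> C \<subset> verts G"
      show "\<exists>u \<in> C. \<exists>w. neighbors G u - C = {w}"
      \<comment> \<open>A blue center forces \<open>v\<close>; a white center is forced by any leaf
        other than \<open>v\<close>.\<close>
      proof (cases "c \<in> C")
        case True
        then have "neighbors G c - C = {v}" using Nc C L v by auto
        then show ?thesis using True by blast
      next
        case False
        have "card (L - {v}) \<noteq> 0" using L fin assms v by simp
        then obtain u where "u \<in> L - {v}" by (metis card.empty ex_in_conv)
        then have "u \<in> C \<and> neighbors G u - C = {c}" using Nl C False by auto
        then show ?thesis by blast
      qed
    qed (use L in auto)
    show "card (L - B) \<le> 1" if B: "zero_forcing_set G B" for B
    proof (cases "insert c B = verts G")
      case True
      then have "L - B = {}" using L by auto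
      then show ?thesis by (simp only: card.empty)
    next
      case False
      \<comment> \<open>Once the center is blue as well, no leaf can force; the next force comes
        from \<open>c\<close>, which must then have a single white leaf.\<close>
      have sub: "insert c B \<subseteq> verts G" using B L by (auto simp: zero_forcing_set_def)
      obtain u w where u: "u \<in> insert c B" "neighbors G u - insert c B = {w}"
        using zero_forcing_setD[OF B _ sub False] by blast
      then have "u = c" using Nl sub L by blast
      then have "L - B = {w}" using u Nc L by auto
      then show ?thesis by simp
    qed
  qed (use assms in simp)
qed

section \<open>Recognizing complete graphs and stars\<close>

lemma deleted_sets_imp_complete_or_star:
  assumes T: "finite T" "card T = r" "r \<ge> 3" "T \<subseteq> verts G"
    and mz: "\<And>B. min_zero_forcing_set G B \<longleftrightarrow> B \<in> (\<lambda>v. T - {v}) ` T"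
    and deg: "\<And>x. x \<in> verts G \<Longrightarrow> neighbors G x \<noteq> {}"
  shows "complete_digraph r G \<or> complete_bipartite_digraph 1 r G"
proof -
  \<comment> \<open>By reversal the vertices that never force form some \<open>T - {a}\<close>, so
    no vertex of \<open>T\<close> other than \<open>a\<close> forces.\<close>
  have forcer: "x = y" if v: "v \<in> T" and U: "forcing G (T - {v}) (verts G) U"
    and xy: "x \<in> T" "x \<in> U" "y \<in> T" "y \<in> U" for v U x y
  proof -
    have "min_zero_forcing_set G (verts G - U)"
      using min_zero_forcing_set_terminus[OF _ U] mz v by blast
    then obtain a where "verts G - U = T - {a}" using mz by blast
    then show ?thesis using xy T(4) by blast
  qed
  have min: "min_zero_forcing_set G (T - {v})" if "v \<in> T" for v using mz that by blast
  have zfs: "zero_forcing_set G (T - {v})" if "v \<in> T" for v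
    using min[OF that] by (simp add: min_zero_forcing_set_def)
  have white: "neighbors G x - (T - {v}) \<noteq> {}" if "v \<in> T" "x \<in> T - {v}" for v x
    using min_zero_forcing_set_white_neighbor[OF min[OF that(1)] that(2)] deg that T(4) by blast
  show ?thesis
  proof (cases "T = verts G")
    case True
    \<comment> \<open>The only white vertex is \<open>v\<close>, so it is the white neighbor that
      minimality gives \<open>x\<close>.\<close>
    have "v \<in> neighbors G x" if "v \<in> T" "x \<in> T" "x \<noteq> v" for v x
      using white[of v x] that neighbors_subset[of x] True by blast
    then have "u \<rightarrow>\<^bsub>G\<^esub> v \<longleftrightarrow> u \<in> verts G \<and> v \<in> verts G \<and> u \<noteq> v" for u v
      unfolding neighbors_def using adj_in_verts[of u v] adj_not_same[of u] True by blast
    then have "arcs_ends G = {(u, v). (u, v) \<in> verts G \<times> verts G \<and> u \<noteq> v}"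
      by auto
    then show ?thesis using True T graph_axioms by (auto simp: complete_digraph_def)
  next
    case False
    have unique: "\<exists>w. w \<notin> T \<and> (\<forall>x \<in> T - {v}. neighbors G x - (T - {v}) = {w})" if v: "v \<in> T" for v
    proof -
      let ?B = "T - {v}"
      obtain u w where u: "u \<in> ?B" "neighbors G u - ?B = {w}"
        using zero_forcing_setD[OF zfs[OF v], of ?B] v T(4) by blast
      note step = force[OF init u]
      \<comment> \<open>After \<open>u\<close> has forced \<open>w\<close>, any \<open>x\<close>
        with a further white neighbor could be made to force too, giving two forcers in
        \<open>T\<close>.\<close>
      have only: "neighbors G x \<subseteq> insert w ?B" if x: "x \<in> ?B" for x
      proof (rule ccontr)
        assume "\<not> ?thesis"
        then have ne: "neighbors G x - insert w ?B \<noteq> {}" by blast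
        then have "x \<noteq> u" using u by blast
        obtain U where "forcing G ?B (verts G) U" "{x, u} \<subseteq> U"
          using forcing_extend_by[OF zfs[OF v] step _ ne] x by auto
        then show False using forcer[OF v, of U x u] x u \<open>x \<noteq> u\<close> by blast
      qed
      \<comment> \<open>If \<open>u\<close> forced \<open>v\<close> first, then \<open>T\<close>
        would be blue without being everything. Another \<open>y\<close> in \<open>T\<close> could
        force next, since \<open>u\<close> has no white neighbor left: again two forcers in
        \<open>T\<close>.\<close>
      have "w \<noteq> v"
      proof
        assume "w = v"
        then have eq: "insert w ?B = T" using v by auto
        obtain y z where y: "y \<in> T" "neighbors G y - T = {z}"
          using zero_forcing_setD[OF zfs[OF v], of T] T False by blast
        have "y \<noteq> u" using y u eq by blast
        obtain U where "forcing G ?B (verts G) U" "{y, u} \<subseteq> U"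
          using forcing_extend_by[OF zfs[OF v] step[unfolded eq], of y] y by auto
        then show False using forcer[OF v, of U y u] y u \<open>y \<noteq> u\<close> by blast
      qed
      then have "w \<notin> T" using u by blast
      moreover have "neighbors G x - ?B = {w}" if "x \<in> ?B" for x
        using only[OF that] white[OF v that] by blast
      ultimately show ?thesis by blast
    qed
    obtain W where W: "\<And>v. v \<in> T \<Longrightarrow> W v \<notin> T"
      "\<And>v x. v \<in> T \<Longrightarrow> x \<in> T \<Longrightarrow> x \<noteq> v \<Longrightarrow> neighbors G x - (T - {v}) = {W v}"
      using unique by (metis Diff_iff singletonD)
    \<comment> \<open>Starting from \<open>T - {v}\<close>, the vertex \<open>v\<close> is white, so
      as a neighbor of \<open>x\<close> it would be \<open>W v\<close>, which lies outside
      \<open>T\<close>.\<close>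
    have indep: "v \<notin> neighbors G x" if "v \<in> T" "x \<in> T" for v x
    proof
      assume v: "v \<in> neighbors G x"
      then have "x \<noteq> v" using not_self_neighbor by blast
      then have "neighbors G x - (T - {v}) = {W v}" using W(2) that by simp
      then have "v = W v" using v by auto
      then show False using W(1)[OF that(1)] that(1) by simp
    qed
    have NW: "neighbors G x = {W v}" if "v \<in> T" "x \<in> T" "x \<noteq> v" for v x
      using W(2)[OF that] indep that by blast
    have third: "\<exists>z \<in> T. z \<noteq> x \<and> z \<noteq> y" for x y
    proof -
      have "card (T - {x, y}) \<ge> card T - card {x, y}" by (rule diff_card_le_card_Diff) simp
      moreover have "card {x, y} \<le> 2" by (simp add: card_insert_if)
      ultimately have "card (T - {x, y}) \<noteq> 0" using T by linarith
      then have "T - {x, y} \<noteq> {}" by force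
      then show ?thesis by blast
    qed
    obtain t where t: "t \<in> T" using third by blast
    define w where "w = W t"
    have N: "neighbors G x = {w}" if x: "x \<in> T" for x
    proof (cases "x = t")
      case True
      \<comment> \<open>\<open>NW\<close> does not relate \<open>t\<close> to \<open>W t\<close>
        directly. The neighbor of \<open>z\<close> is both \<open>W t\<close> and
        \<open>W y\<close>, and \<open>W y\<close> is the neighbor of \<open>t\<close>; this takes
        three elements of \<open>T\<close>.\<close>
      obtain z where z: "z \<in> T" "z \<noteq> t" using third by blast
      obtain y where "y \<in> T" "y \<noteq> t" "y \<noteq> z" using third by blast
      then show ?thesis using NW[of z t] NW[of z y] NW[of t y] z t True w_def by auto
    qed (use NW t x w_def in auto)
    have w: "w \<notin> T" "w \<in> verts G" using W(1) t w_def N[OF t] neighbors_subset[of t] by auto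
    have Tw: "T \<subseteq> neighbors G w" using N neighbors_sym by blast
    \<comment> \<open>With \<open>w\<close> blue and \<open>t\<close> white, the vertices of
      \<open>T - {t}\<close> are finished, so \<open>w\<close> must force; its only white neighbor
      is \<open>t\<close>, hence all its neighbors lie in \<open>T\<close>.\<close>
    have "t \<in> verts G" "t \<notin> insert w (T - {t})" using t w T(4) by blast+
    then have ne: "insert w (T - {t}) \<noteq> verts G" by metis
    have sub: "insert w (T - {t}) \<subseteq> verts G" using w T(4) by blast
    obtain u z where u: "u \<in> insert w (T - {t})" "neighbors G u - insert w (T - {t}) = {z}"
      using zero_forcing_setD[OF zfs[OF t] _ sub ne] by blast
    have "u = w"
    proof (rule ccontr)
      assume "u \<noteq> w"
      then have "neighbors G u = {w}" using N u(1) by blast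
      then show False using u(2) by auto
    qed
    moreover have "t \<in> neighbors G w - insert w (T - {t})" using Tw t w by auto
    ultimately have "neighbors G w - insert w (T - {t}) = {t}" using u(2) by (metis singletonD)
    then have "neighbors G w \<subseteq> insert w (T - {t}) \<union> {t}"
      by (metis Diff_subset_conv subset_refl)
    then have "neighbors G w \<subseteq> T" using t not_self_neighbor[of w] by blast
    then have Nw: "neighbors G w = T" using Tw by (rule subset_antisym)
    \<comment> \<open>The set \<open>insert w T\<close> is closed under neighbors, so the process
      would be stuck there.\<close>
    have V: "insert w T = verts G"
    proof (rule ccontr)
      assume ne: "insert w T \<noteq> verts G"
      have sub: "insert w T \<subseteq> verts G" using w T by blast
      obtain u z where "u \<in> insert w T" "neighbors G u - insert w T = {z}"
        using zero_forcing_setD[OF zfs[OF t] _ sub ne] by blast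
      moreover have "neighbors G u \<subseteq> insert w T" if "u \<in> insert w T" for u
        using that N[of u] Nw by auto
      ultimately show False by blast
    qed
    have "arcs_ends G = {w} \<times> T \<union> T \<times> {w}"
    proof -
      have "u \<rightarrow>\<^bsub>G\<^esub> v \<longleftrightarrow> u = w \<and> v \<in> T \<or> u \<in> T \<and> v = w" for u v
      proof -
        have adj: "u \<rightarrow>\<^bsub>G\<^esub> v \<longleftrightarrow> v \<in> neighbors G u" by (simp add: neighbors_def)
        consider "u = w" | "u \<in> T" "u \<noteq> w" | "u \<notin> verts G" "u \<noteq> w" "u \<notin> T" using V by blast
        then show ?thesis
        proof cases
          case 3
          then show ?thesis using adj_in_verts(1)[of u v] by blast
        qed (use adj Nw N[of u] w(1) in simp_all)
      qed
      then show ?thesis by auto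
    qed
    then have "verts G = {w} \<union> T \<and> {w} \<inter> T = {} \<and> card {w} = 1 \<and> card T = r \<and>
        arcs_ends G = {w} \<times> T \<union> T \<times> {w}"
      using V w(1) T(2) by simp
    then have "complete_bipartite_digraph 1 r G"
      unfolding complete_bipartite_digraph_def using graph_axioms by blast
    then show ?thesis ..
  qed
qed

section \<open>Recovering the graph from its zero forcing graph\<close>

lemma connected_neighbors_nonempty:
  assumes "Digraph_Component.connected G" "x \<in> verts G" "y \<in> verts G" "x \<noteq> y"
  shows "neighbors G x \<noteq> {}"
proof -
  have "x \<rightarrow>\<^sup>*\<^bsub>G\<^esub> y"
    using symmetric_connected_imp_strongly_connected[OF sym_arcs assms(1)] assms
    unfolding strongly_connected_def by blast
  then show ?thesis
    using assms(4) by (cases rule: converse_reachable_cases) (auto simp: neighbors_def)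
qed

lemma complete_zero_forcing_graphD:
  assumes "Digraph_Component.connected G" "r \<ge> 3"
    and "complete_digraph r (with_proj (zero_forcing_graph G))"
  shows "complete_digraph r G \<or> complete_bipartite_digraph 1 r G"
proof -
  let ?F = "{B. min_zero_forcing_set G B}"
  have F: "finite ?F" "card ?F = r"
    and two: "\<And>A B. A \<in> ?F \<Longrightarrow> B \<in> ?F \<Longrightarrow> A \<noteq> B \<Longrightarrow> card ((A - B) \<union> (B - A)) = 2"
    using assms(3) unfolding complete_digraph_zero_forcing_graph_iff by auto
  have zfs: "zero_forcing_set G B" "B \<subseteq> verts G" "finite B" "card B = zero_forcing_number G"
    if "B \<in> ?F" for B
    using that finite_subset[OF _ finite_verts]
    by (auto simp: min_zero_forcing_set_def zero_forcing_set_def)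
  have "\<exists>X \<subseteq> ?F. card X = 3" using obtain_subset_with_card_n[of 3 ?F] F assms(2) by metis
  then obtain A B D where ABD: "A \<in> ?F" "B \<in> ?F" "D \<in> ?F" "A \<noteq> B" "A \<noteq> D" "B \<noteq> D"
    by (auto simp: card_3_iff)
  \<comment> \<open>On at most one vertex \<open>A\<close> and \<open>B\<close> would be nested,
    hence equal since they have the same size.\<close>
  have "\<exists>x y. x \<in> verts G \<and> y \<in> verts G \<and> x \<noteq> y"
  proof (rule ccontr)
    assume "\<not> ?thesis"
    then have "A \<subseteq> B \<or> B \<subseteq> A" using zfs(2) ABD by blast
    then show False using zfs(3,4) ABD by (metis card_subset_eq)
  qed
  then have deg: "neighbors G x \<noteq> {}" if "x \<in> verts G" for x
    using connected_neighbors_nonempty[OF assms(1) that] by metis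
  have avoid: "\<exists>B \<in> ?F. x \<notin> B" if "x \<in> verts G" for x
    using min_zero_forcing_set_avoiding[of A x] deg[OF that] ABD(1) by blast
  show ?thesis
  proof (rule family_symmetric_difference_two[of ?F "zero_forcing_number G", OF zfs(3,4) two ABD(1,2,4)])
    fix S assume S: "\<And>D. D \<in> ?F \<Longrightarrow> S \<subseteq> D" "Suc (card S) = zero_forcing_number G"
    have "S = {}" using S(1) avoid zfs(2) ABD(1) by blast
    then have "card X = 1" if "X \<in> ?F" for X using S(2) zfs(4)[OF that] by simp
    then obtain x y z where "A = {x}" "B = {y}" "D = {z}"
      using ABD by (metis card_1_singletonE)
    then show ?thesis using singleton_zero_forcing_sets[of x y z] zfs(1) ABD by auto
  next
    fix T assume T: "finite T" "card T = Suc (zero_forcing_number G)" "\<And>D. D \<in> ?F \<Longrightarrow> D \<subseteq> T"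
    have delete: "\<exists>v \<in> T. X = T - {v}" if X: "X \<in> ?F" for X
    proof -
      have "card (T - X) = 1" using T zfs X by (simp add: card_Diff_subset)
      then obtain v where "T - X = {v}" by (meson card_1_singletonE)
      then show ?thesis using T(3)[OF X] by blast
    qed
    have "T = A \<union> B"
      using delete[OF ABD(1)] delete[OF ABD(2)] ABD(4) by blast
    then have TV: "T \<subseteq> verts G" using zfs(2) ABD by blast
    \<comment> \<open>A minimum set avoiding \<open>v\<close> deletes some vertex from
      \<open>T\<close>, and this can only be \<open>v\<close>.\<close>
    have "T - {v} \<in> ?F" if v: "v \<in> T" for v
    proof -
      obtain X where "X \<in> ?F" "v \<notin> X" using avoid v TV by blast
      then show ?thesis using delete[of X] v by blast
    qed
    then have eq: "?F = (\<lambda>v. T - {v}) ` T" using delete by blast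
    then have "card T = r" using bij_betw_same_card[OF bij_betw_delete[of T]] F by metis
    then show ?thesis
      using deleted_sets_imp_complete_or_star[OF T(1) _ assms(2) TV _ deg] eq by blast
  qed auto
qed

end

theorem proposition4p2:
  fixes G :: "('a, 'b) pre_digraph" and r :: nat
  assumes "graph G"
    and "Digraph_Component.connected G"
    and "r \<ge> 3"
  shows "complete_digraph r (with_proj (zero_forcing_graph G)) \<longleftrightarrow>
    complete_digraph r G \<or> complete_bipartite_digraph 1 r G"
proof -
  interpret graph G by fact
  show ?thesis
    using complete_zero_forcing_graphD[OF assms(2,3)] zero_forcing_graph_complete[of r]
      zero_forcing_graph_star[of r] assms(3) by linarith
qed

end
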